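(* In the setting described in the context, the consistent solution $P^{\mathrm{post}}_{\Lambda}$ of the stochastic inverse problem is stable with respect to perturbations in $P^{\mathrm{obs}}_{\mathcal{D}}$; that is, for every $\epsilon>0$ there exists $\delta>0$ such that for every perturbation $\widehat{P}^{\mathrm{obs}}_{\mathcal{D}}$ of $P^{\mathrm{obs}}_{\mathcal{D}}$ (as defined in the context), with associated consistent solution $\widehat{P}^{\mathrm{post}}_{\Lambda}$, $$d_{TV}\big(P^{\mathrm{obs}}_{\mathcal{D}},\widehat{P}^{\mathrm{obs}}_{\mathcal{D}}\big)<\delta\ \Longrightarrow\ d_{TV}\big(P^{\mathrm{post}}_{\Lambda},\widehat{P}^{\mathrm{post}}_{\Lambda}\big)<\epsilon.$$
   Context: Setting. $\Lambda\subset\mathbb{R}^n$ and $\mathcal{D}\subset\mathbb{R}^m$ are finite-dimensional metric spaces with Borel $\sigma$-algebras $\mathcal{B}_{\Lambda}$, $\mathcal{B}_{\mathcal{D}}$ and (volume) measures $\mu_{\Lambda}$, $\mu_{\mathcal{D}}$. $Q:\Lambda\to\mathcal{D}$ is a measurable map and $\mathcal{D}=Q(\Lambda)$. Assumption 1: either $\mu_{\mathcal{D}}$ is the push-forward volume measure $A\mapsto\mu_{\Lambda}(Q^{-1}(A))$, or the push-forward volume measure is absolutely continuous with respect to $\mu_{\mathcal{D}}$. The family $\{\mu_{\Lambda,q}\}_{q\in\mathcal{D}}$ is the disintegration of $\mu_{\Lambda}$ along $Q$ with respect to $\mu_{\mathcal{D}}$: each $\mu_{\Lambda,q}$ is a measure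 on $(\Lambda,\mathcal{B}_{\Lambda})$ with $\mu_{\Lambda,q}(\Lambda\setminus Q^{-1}(q))=0$, for each $A\in\mathcal{B}_{\Lambda}$ the map $q\mapsto\mu_{\Lambda,q}(A)$ is measurable, and $\mu_{\Lambda}(A)=\int_{\mathcal{D}}\mu_{\Lambda,q}(A\cap Q^{-1}(q))\,d\mu_{\mathcal{D}}(q)$. The prior $P^{\mathrm{prior}}_{\Lambda}$ is a probability measure on $(\Lambda,\mathcal{B}_{\Lambda})$ with density $\pi^{\mathrm{prior}}_{\Lambda}$ with respect to $\mu_{\Lambda}$. Its push-forward $P^{Q(\mathrm{prior})}_{\mathcal{D}}(A)=P^{\mathrm{prior}}_{\Lambda}(Q^{-1}(A))$ has density $\pi^{Q(\mathrm{prior})}_{\mathcal{D}}$ with respect to $\mu_{\mathcal{D}}$, given by $\pi^{Q(\mathrm{prior})}_{\mathcal{D}}(q)=\int_{Q^{-1}(q)}\pi^{\mathrm{prior}}_{\Lambda}(\lambda)\,d\mu_{\Lambda,q}(\lambda)$. The observed measure $P^{\mathrm{obs}}_{\mathcal{D}}$ is a probability measure on $(\mathcal{D},\mathcal{B}_{\mathcal{D}})$ with density $\pi^{\mathrm{obs}}_{\mathcal{D}}$ with respect to $\mu_{\mathcal{D}}$. Assumption 2: there is a constant $C>0$ such that $\pi^{\mathrm{obs}}_{\mathcal{D}}(q)\le C\,\pi^{Q(\mathrm{prior})}_{\mathcal{D}}(q)$ for $\mu_{\mathcal{D}}$-a.e. $q\in\mathcal{D}$. Convention: a quotient is read as $0$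 at points where its denominator $\pi^{Q(\mathrm{prior})}_{\mathcal{D}}$ vanishes. The consistent solution associated with $P^{\mathrm{prior}}_{\Lambda}$ and $P^{\mathrm{obs}}_{\mathcal{D}}$ is $$P^{\mathrm{post}}_{\Lambda}(A)=\int_{\mathcal{D}}\left(\int_{A\cap Q^{-1}(q)}\pi^{\mathrm{prior}}_{\Lambda}(\lambda)\,\frac{\pi^{\mathrm{obs}}_{\mathcal{D}}(Q(\lambda))}{\pi^{Q(\mathrm{prior})}_{\mathcal{D}}(Q(\lambda))}\,d\mu_{\Lambda,q}(\lambda)\right)d\mu_{\mathcal{D}}(q),\quad A\in\mathcal{B}_{\Lambda},$$ whose density with respect to $\mu_{\Lambda}$ is $\pi^{\mathrm{post}}_{\Lambda}(\lambda)=\pi^{\mathrm{prior}}_{\Lambda}(\lambda)\,\pi^{\mathrm{obs}}_{\mathcal{D}}(Q(\lambda))/\pi^{Q(\mathrm{prior})}_{\mathcal{D}}(Q(\lambda))$. A perturbation of $P^{\mathrm{obs}}_{\mathcal{D}}$ is any probability measure $\widehat{P}^{\mathrm{obs}}_{\mathcal{D}}$ on $(\mathcal{D},\mathcal{B}_{\mathcal{D}})$ with a density $\widehat{\pi}^{\mathrm{obs}}_{\mathcal{D}}$ with respect to $\mu_{\mathcal{D}}$ that satisfies Assumption 2 with the same prior (i.e. $\widehat{\pi}^{\mathrm{obs}}_{\mathcal{D}}\le C'\,\pi^{Q(\mathrm{prior})}_{\mathcal{D}}$ $\mu_{\mathcal{D}}$-a.e. for some constant $C'>0$). Its associated consistent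 solution $\widehat{P}^{\mathrm{post}}_{\Lambda}$ is given by the formula for $P^{\mathrm{post}}_{\Lambda}$ with $\pi^{\mathrm{obs}}_{\mathcal{D}}$ replaced by $\widehat{\pi}^{\mathrm{obs}}_{\mathcal{D}}$. Total variation distance (without factor $1/2$): for measures with densities $\pi_1,\pi_2$ with respect to a volume measure $\mu$ ($\mu=\mu_{\Lambda}$ on $\Lambda$, $\mu=\mu_{\mathcal{D}}$ on $\mathcal{D}$), $d_{TV}=\int|\pi_1-\pi_2|\,d\mu$. *)

theory Defs
  imports "HOL-Probability.Probability"
begin

definition has_density :: "'a measure \<Rightarrow> 'a measure \<Rightarrow> ('a \<Rightarrow> real) \<Rightarrow> bool" where
  "has_density M P f \<longleftrightarrow>
     f \<in> borel_measurable M \<and> (\<forall>x\<in>space M. 0 \<le> f x) \<and> P = density M (\<lambda>x. ennreal (f x))"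

text \<open>
  Total variation distance with respect to the volume measure \<open>M\<close>, without the factor 1/2.
  For finite measures with densities the set below is a singleton (densities are unique up to
  null sets, see \<open>tv_dist_eq\<close>), so the infimum merely selects its value.  If one of the measures
  has no density the set is empty and the distance is infinite.
\<close>

definition tv_dist :: "'a measure \<Rightarrow> 'a measure \<Rightarrow> 'a measure \<Rightarrow> ennreal" where
  "tv_dist M P1 P2 =
     Inf {\<integral>\<^sup>+x. ennreal \<bar>f1 x - f2 x\<bar> \<partial>M | f1 f2. has_density M P1 f1 \<and> has_density M P2 f2}"

definition disintegration ::
  "'a measure \<Rightarrow> 'b measure \<Rightarrow> ('a \<Rightarrow> 'b) \<Rightarrow> ('b \<Rightarrow> 'a measure) \<Rightarrow> bool" where
  "disintegration \<mu>\<Lambda> \<mu>D Q \<mu>q \<longleftrightarrow>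
     (\<forall>q\<in>space \<mu>D. sets (\<mu>q q) = sets \<mu>\<Lambda>) \<and>
     (\<forall>q\<in>space \<mu>D. emeasure (\<mu>q q) (space \<mu>\<Lambda> - Q -` {q}) = 0) \<and>
     (\<forall>A\<in>sets \<mu>\<Lambda>. (\<lambda>q. emeasure (\<mu>q q) A) \<in> borel_measurable \<mu>D) \<and>
     (\<forall>A\<in>sets \<mu>\<Lambda>. emeasure \<mu>\<Lambda> A = (\<integral>\<^sup>+q. emeasure (\<mu>q q) (A \<inter> Q -` {q}) \<partial>\<mu>D))"

text \<open>
  The density of the push-forward of the prior.  The fibre integral is finite for almost every
  \<open>q\<close>; on the exceptional null set the Bochner integral takes the value 0.
\<close>

definition push_prior_density ::
  "'a measure \<Rightarrow> ('a \<Rightarrow> 'b) \<Rightarrow> ('b \<Rightarrow> 'a measure) \<Rightarrow> ('a \<Rightarrow> real) \<Rightarrow> 'b \<Rightarrow> real" where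
  "push_prior_density \<mu>\<Lambda> Q \<mu>q \<pi>prior q =
     (LINT l:(space \<mu>\<Lambda> \<inter> Q -` {q})|\<mu>q q. \<pi>prior l)"

definition predictable :: "'b measure \<Rightarrow> ('b \<Rightarrow> real) \<Rightarrow> ('b \<Rightarrow> real) \<Rightarrow> bool" where
  "predictable \<mu>D \<pi>push \<pi>obs \<longleftrightarrow> (\<exists>C>0. AE q in \<mu>D. \<pi>obs q \<le> C * \<pi>push q)"

text \<open>
  The posterior density uses \<open>x / 0 = 0\<close> on the reals, which is the required convention
  for quotients with vanishing denominator.
\<close>

definition posterior_density ::
  "'a measure \<Rightarrow> ('a \<Rightarrow> 'b) \<Rightarrow> ('b \<Rightarrow> 'a measure) \<Rightarrow> ('a \<Rightarrow> real) \<Rightarrow> ('b \<Rightarrow> real) \<Rightarrow> 'a \<Rightarrow> real" where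
  "posterior_density \<mu>\<Lambda> Q \<mu>q \<pi>prior \<pi>obs l =
     \<pi>prior l * (\<pi>obs (Q l) / push_prior_density \<mu>\<Lambda> Q \<mu>q \<pi>prior (Q l))"

text \<open>
  The iterated integral defining the consistent solution is countably additive in the present
  setting, so that \<open>measure_of\<close> returns the measure with exactly these values
  (see \<open>emeasure_posterior\<close>).
\<close>

definition posterior ::
  "'a measure \<Rightarrow> 'b measure \<Rightarrow> ('a \<Rightarrow> 'b) \<Rightarrow> ('b \<Rightarrow> 'a measure) \<Rightarrow>
     ('a \<Rightarrow> real) \<Rightarrow> ('b \<Rightarrow> real) \<Rightarrow> 'a measure" where
  "posterior \<mu>\<Lambda> \<mu>D Q \<mu>q \<pi>prior \<pi>obs =
     measure_of (space \<mu>\<Lambda>) (sets \<mu>\<Lambda>)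
       (\<lambda>A. \<integral>\<^sup>+q. (\<integral>\<^sup>+l\<in>A \<inter> Q -` {q}.
          ennreal (posterior_density \<mu>\<Lambda> Q \<mu>q \<pi>prior \<pi>obs l) \<partial>\<mu>q q) \<partial>\<mu>D)"


lemma tv_dist_eq:
  assumes f: "has_density M P1 f" and g: "has_density M P2 g"
    and "finite_measure P1" "finite_measure P2"
  shows "tv_dist M P1 P2 = (\<integral>\<^sup>+x. ennreal \<bar>f x - g x\<bar> \<partial>M)"
proof -
  have uniq: "AE x in M. h x = h' x"
    if h: "has_density M P h" and h': "has_density M P h'" and fin: "finite_measure P" for P h h'
  proof -
    have [measurable]: "h \<in> borel_measurable M" "h' \<in> borel_measurable M"
      using h h' by (auto simp: has_density_def)
    have "emeasure P (space P) \<noteq> \<infinity>"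
      using finite_measure.emeasure_finite[OF fin] by simp
    then have "(\<integral>\<^sup>+x. ennreal (h x) \<partial>M) \<noteq> \<infinity>"
      using h by (auto simp: has_density_def emeasure_density cong: nn_integral_cong)
    moreover have "density M (\<lambda>x. ennreal (h x)) = density M (\<lambda>x. ennreal (h' x))"
      using h h' by (simp add: has_density_def)
    ultimately have "AE x in M. ennreal (h x) = ennreal (h' x)"
      by (subst (asm) finite_density_unique) auto
    then show ?thesis
      using h h' by (auto simp: has_density_def elim!: AE_mp intro!: AE_I2)
  qed
  have "{\<integral>\<^sup>+x. ennreal \<bar>f1 x - f2 x\<bar> \<partial>M | f1 f2. has_density M P1 f1 \<and> has_density M P2 f2}
        = {\<integral>\<^sup>+x. ennreal \<bar>f x - g x\<bar> \<partial>M}"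
  proof (intro equalityI subsetI)
    fix v assume "v \<in> {\<integral>\<^sup>+x. ennreal \<bar>f1 x - f2 x\<bar> \<partial>M | f1 f2.
                        has_density M P1 f1 \<and> has_density M P2 f2}"
    then obtain f1 f2 where v: "v = (\<integral>\<^sup>+x. ennreal \<bar>f1 x - f2 x\<bar> \<partial>M)"
      and d: "has_density M P1 f1" "has_density M P2 f2" by auto
    have "(\<integral>\<^sup>+x. ennreal \<bar>f1 x - f2 x\<bar> \<partial>M) = (\<integral>\<^sup>+x. ennreal \<bar>f x - g x\<bar> \<partial>M)"
      using uniq[OF d(1) f] uniq[OF d(2) g] assms(3,4)
      by (intro nn_integral_cong_AE) (auto elim!: eventually_elim2)
    with v show "v \<in> {\<integral>\<^sup>+x. ennreal \<bar>f x - g x\<bar> \<partial>M}" by simp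
  qed (use f g in auto)
  then show ?thesis by (simp add: tv_dist_def)
qed

lemma disintegration_nn_integral:
  assumes dis: "disintegration \<mu>\<Lambda> \<mu>D Q \<mu>q" and f: "f \<in> borel_measurable \<mu>\<Lambda>"
    and fib: "\<And>q. q \<in> space \<mu>D \<Longrightarrow> space \<mu>\<Lambda> \<inter> Q -` {q} \<in> sets \<mu>\<Lambda>"
  shows "(\<lambda>q. \<integral>\<^sup>+l. f l \<partial>\<mu>q q) \<in> borel_measurable \<mu>D \<and>
         (\<integral>\<^sup>+l. f l \<partial>\<mu>\<Lambda>) = (\<integral>\<^sup>+q. (\<integral>\<^sup>+l. f l \<partial>\<mu>q q) \<partial>\<mu>D)"
proof -
  have sets_q: "sets (\<mu>q q) = sets \<mu>\<Lambda>" if "q \<in> space \<mu>D" for q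
    using dis that by (simp add: disintegration_def)
  have meas_q: "u \<in> borel_measurable (\<mu>q q)" if "q \<in> space \<mu>D" "u \<in> borel_measurable \<mu>\<Lambda>"
    for q and u :: "'a \<Rightarrow> ennreal"
    using that sets_q measurable_cong_sets by blast
  have em: "emeasure (\<mu>q q) (A \<inter> Q -` {q}) = emeasure (\<mu>q q) A"
    if q: "q \<in> space \<mu>D" and A: "A \<in> sets \<mu>\<Lambda>" for q A
  proof -
    have N: "space \<mu>\<Lambda> - Q -` {q} \<in> null_sets (\<mu>q q)"
    proof (rule null_setsI)
      show "emeasure (\<mu>q q) (space \<mu>\<Lambda> - Q -` {q}) = 0"
        using dis q by (simp add: disintegration_def)
      have "space \<mu>\<Lambda> - (space \<mu>\<Lambda> \<inter> Q -` {q}) \<in> sets \<mu>\<Lambda>" using fib[OF q] by blast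
      then show "space \<mu>\<Lambda> - Q -` {q} \<in> sets (\<mu>q q)"
        using sets_q[OF q] by (simp add: Diff_Int)
    qed
    have "A \<inter> Q -` {q} = A - (space \<mu>\<Lambda> - Q -` {q})"
      using sets.sets_into_space[OF A] by blast
    then show ?thesis
      using emeasure_Diff_null_set[OF N] A sets_q[OF q] by simp
  qed
  show ?thesis
    using f
  proof (induction rule: borel_measurable_induct)
    case (cong f g)
    have "(\<integral>\<^sup>+l. f l \<partial>\<mu>q q) = (\<integral>\<^sup>+l. g l \<partial>\<mu>q q)" if "q \<in> space \<mu>D" for q
      using cong(3) sets_eq_imp_space_eq[OF sets_q[OF that]] by (intro nn_integral_cong) simp
    moreover have "(\<integral>\<^sup>+l. f l \<partial>\<mu>\<Lambda>) = (\<integral>\<^sup>+l. g l \<partial>\<mu>\<Lambda>)"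
      using cong(3) by (intro nn_integral_cong) simp
    ultimately show ?case
      using cong(4) by (simp cong: measurable_cong nn_integral_cong)
  next
    case (set A)
    have *: "(\<integral>\<^sup>+l. indicator A l \<partial>\<mu>q q) = emeasure (\<mu>q q) A" if "q \<in> space \<mu>D" for q
      using set sets_q[OF that] by simp
    have "(\<lambda>q. emeasure (\<mu>q q) A) \<in> borel_measurable \<mu>D"
      and "emeasure \<mu>\<Lambda> A = (\<integral>\<^sup>+q. emeasure (\<mu>q q) (A \<inter> Q -` {q}) \<partial>\<mu>D)"
      using dis set by (auto simp: disintegration_def)
    then show ?case
      using set * em by (simp cong: measurable_cong nn_integral_cong)
  next
    case (mult u c)
    have *: "(\<integral>\<^sup>+l. c * u l \<partial>\<mu>q q) = c * (\<integral>\<^sup>+l. u l \<partial>\<mu>q q)" if "q \<in> space \<mu>D" for q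
      by (rule nn_integral_cmult, rule meas_q[OF that], fact mult)
    have [measurable]: "u \<in> borel_measurable \<mu>\<Lambda>" by (fact mult)
    have [measurable]: "(\<lambda>q. \<integral>\<^sup>+l. u l \<partial>\<mu>q q) \<in> borel_measurable \<mu>D"
      and eq: "(\<integral>\<^sup>+l. u l \<partial>\<mu>\<Lambda>) = (\<integral>\<^sup>+q. (\<integral>\<^sup>+l. u l \<partial>\<mu>q q) \<partial>\<mu>D)"
      using mult by blast+
    have "(\<lambda>q. \<integral>\<^sup>+l. c * u l \<partial>\<mu>q q) \<in> borel_measurable \<mu>D"
      by (subst measurable_cong[OF *]) auto
    moreover have "(\<integral>\<^sup>+q. (\<integral>\<^sup>+l. c * u l \<partial>\<mu>q q) \<partial>\<mu>D) = (\<integral>\<^sup>+l. c * u l \<partial>\<mu>\<Lambda>)"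
      by (subst nn_integral_cong[OF *], assumption) (simp add: eq nn_integral_cmult)
    ultimately show ?case by simp
  next
    case (add u v)
    have *: "(\<integral>\<^sup>+l. v l + u l \<partial>\<mu>q q) = (\<integral>\<^sup>+l. v l \<partial>\<mu>q q) + (\<integral>\<^sup>+l. u l \<partial>\<mu>q q)"
      if "q \<in> space \<mu>D" for q
      by (rule nn_integral_add; rule meas_q[OF that]; fact add)
    have [measurable]: "u \<in> borel_measurable \<mu>\<Lambda>" "v \<in> borel_measurable \<mu>\<Lambda>"
      by (fact add)+
    have [measurable]: "(\<lambda>q. \<integral>\<^sup>+l. u l \<partial>\<mu>q q) \<in> borel_measurable \<mu>D"
        "(\<lambda>q. \<integral>\<^sup>+l. v l \<partial>\<mu>q q) \<in> borel_measurable \<mu>D"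
      and eq: "(\<integral>\<^sup>+l. u l \<partial>\<mu>\<Lambda>) = (\<integral>\<^sup>+q. (\<integral>\<^sup>+l. u l \<partial>\<mu>q q) \<partial>\<mu>D)"
        "(\<integral>\<^sup>+l. v l \<partial>\<mu>\<Lambda>) = (\<integral>\<^sup>+q. (\<integral>\<^sup>+l. v l \<partial>\<mu>q q) \<partial>\<mu>D)"
      using add by blast+
    have "(\<lambda>q. \<integral>\<^sup>+l. v l + u l \<partial>\<mu>q q) \<in> borel_measurable \<mu>D"
      by (subst measurable_cong[OF *]) auto
    moreover have "(\<integral>\<^sup>+q. (\<integral>\<^sup>+l. v l + u l \<partial>\<mu>q q) \<partial>\<mu>D) = (\<integral>\<^sup>+l. v l + u l \<partial>\<mu>\<Lambda>)"
      by (subst nn_integral_cong[OF *], assumption) (simp add: eq nn_integral_add)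
    ultimately show ?case by simp
  next
    case (seq U)
    have U: "U i \<in> borel_measurable \<mu>\<Lambda>" for i by (rule seq)
    have SUP: "(\<integral>\<^sup>+l. (SUP i. U i) l \<partial>M) = (SUP i. \<integral>\<^sup>+l. U i l \<partial>M)"
      if "sets M = sets \<mu>\<Lambda>" for M
      unfolding SUP_apply
      by (rule nn_integral_monotone_convergence_SUP, rule seq)
        (use U measurable_cong_sets[OF that refl] in blast)
    have *: "(\<integral>\<^sup>+l. (SUP i. U i) l \<partial>\<mu>q q) = (SUP i. \<integral>\<^sup>+l. U i l \<partial>\<mu>q q)"
      if "q \<in> space \<mu>D" for q
      by (rule SUP[OF sets_q[OF that]])
    have IH: "(\<lambda>q. \<integral>\<^sup>+l. U i l \<partial>\<mu>q q) \<in> borel_measurable \<mu>D"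
        "(\<integral>\<^sup>+l. U i l \<partial>\<mu>\<Lambda>) = (\<integral>\<^sup>+q. (\<integral>\<^sup>+l. U i l \<partial>\<mu>q q) \<partial>\<mu>D)" for i
      using seq.IH[of i] by blast+
    note [measurable] = IH(1)
    have "incseq (\<lambda>i q. \<integral>\<^sup>+l. U i l \<partial>\<mu>q q)"
      using seq.hyps by (auto simp: incseq_def le_fun_def intro!: nn_integral_mono)
    then have "(\<integral>\<^sup>+q. (SUP i. \<integral>\<^sup>+l. U i l \<partial>\<mu>q q) \<partial>\<mu>D) = (SUP i. \<integral>\<^sup>+l. U i l \<partial>\<mu>\<Lambda>)"
      unfolding IH(2) by (rule nn_integral_monotone_convergence_SUP) (rule IH)
    also have "\<dots> = (\<integral>\<^sup>+l. (SUP i. U i) l \<partial>\<mu>\<Lambda>)"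
      by (rule SUP[symmetric]) (rule refl)
    finally have "(\<integral>\<^sup>+q. (\<integral>\<^sup>+l. (SUP i. U i) l \<partial>\<mu>q q) \<partial>\<mu>D) = (\<integral>\<^sup>+l. (SUP i. U i) l \<partial>\<mu>\<Lambda>)"
      by (subst nn_integral_cong[OF *])
    moreover have "(\<lambda>q. \<integral>\<^sup>+l. (SUP i. U i) l \<partial>\<mu>q q) \<in> borel_measurable \<mu>D"
      by (subst measurable_cong[OF *]) auto
    ultimately show ?case by simp
  qed
qed

lemma emeasure_posterior:
  fixes \<mu>\<Lambda> :: "'a measure" and \<mu>D :: "'b measure"
  assumes dis: "disintegration \<mu>\<Lambda> \<mu>D Q \<mu>q"
    and fib: "\<And>q. q \<in> space \<mu>D \<Longrightarrow> space \<mu>\<Lambda> \<inter> Q -` {q} \<in> sets \<mu>\<Lambda>"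
    and Q[measurable]: "Q \<in> \<mu>\<Lambda> \<rightarrow>\<^sub>M \<mu>D"
    and prior: "has_density \<mu>\<Lambda> Pprior \<pi>prior" and obs: "has_density \<mu>D Pobs \<pi>obs"
    and A: "A \<in> sets \<mu>\<Lambda>"
  defines "\<pi>post \<equiv> posterior_density \<mu>\<Lambda> Q \<mu>q \<pi>prior \<pi>obs"
  shows "emeasure (posterior \<mu>\<Lambda> \<mu>D Q \<mu>q \<pi>prior \<pi>obs) A =
           (\<integral>\<^sup>+q. (\<integral>\<^sup>+l\<in>A \<inter> Q -` {q}. ennreal (\<pi>post l) \<partial>\<mu>q q) \<partial>\<mu>D)"
    and "has_density \<mu>\<Lambda> (posterior \<mu>\<Lambda> \<mu>D Q \<mu>q \<pi>prior \<pi>obs) \<pi>post"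
proof -
  have sets_q: "sets (\<mu>q q) = sets \<mu>\<Lambda>" if "q \<in> space \<mu>D" for q
    using dis that by (simp add: disintegration_def)
  note space_q = sets_eq_imp_space_eq[OF sets_q]
  have AE_q: "AE l in \<mu>q q. Q l = q" if q: "q \<in> space \<mu>D" for q
  proof (rule AE_I)
    show "{l \<in> space (\<mu>q q). Q l \<noteq> q} \<subseteq> space \<mu>\<Lambda> - Q -` {q}"
      using space_q[OF q] by auto
    show "emeasure (\<mu>q q) (space \<mu>\<Lambda> - Q -` {q}) = 0"
      using dis q by (simp add: disintegration_def)
    have "space \<mu>\<Lambda> - (space \<mu>\<Lambda> \<inter> Q -` {q}) \<in> sets \<mu>\<Lambda>" using fib[OF q] by blast
    then show "space \<mu>\<Lambda> - Q -` {q} \<in> sets (\<mu>q q)"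
      using sets_q[OF q] by (simp add: Diff_Int)
  qed
  have [measurable]: "\<pi>prior \<in> borel_measurable \<mu>\<Lambda>" "\<pi>obs \<in> borel_measurable \<mu>D"
    and pos: "\<And>l. l \<in> space \<mu>\<Lambda> \<Longrightarrow> 0 \<le> \<pi>prior l" "\<And>q. q \<in> space \<mu>D \<Longrightarrow> 0 \<le> \<pi>obs q"
    using prior obs by (auto simp: has_density_def)
  let ?p = "push_prior_density \<mu>\<Lambda> Q \<mu>q \<pi>prior"
  have p_eq: "?p q = enn2real (\<integral>\<^sup>+l. ennreal (\<pi>prior l) \<partial>\<mu>q q)" if q: "q \<in> space \<mu>D" for q
  proof -
    have mq: "\<pi>prior \<in> borel_measurable (\<mu>q q)" "space \<mu>\<Lambda> \<inter> Q -` {q} \<in> sets (\<mu>q q)"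
      using sets_q[OF q] fib[OF q] measurable_cong_sets[OF sets_q[OF q] refl] by auto
    have "?p q = (\<integral>l. \<pi>prior l \<partial>\<mu>q q)"
      unfolding push_prior_density_def set_lebesgue_integral_def
    proof (intro integral_cong_AE)
      show "(\<lambda>l. indicat_real (space \<mu>\<Lambda> \<inter> Q -` {q}) l *\<^sub>R \<pi>prior l) \<in> borel_measurable (\<mu>q q)"
        by (intro borel_measurable_scaleR borel_measurable_indicator mq)
      show "AE l in \<mu>q q. indicat_real (space \<mu>\<Lambda> \<inter> Q -` {q}) l *\<^sub>R \<pi>prior l = \<pi>prior l"
        using AE_q[OF q] AE_space by eventually_elim (simp add: space_q[OF q])
    qed (rule mq)
    also have "\<dots> = enn2real (\<integral>\<^sup>+l. ennreal (\<pi>prior l) \<partial>\<mu>q q)"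
      using mq pos space_q[OF q] by (intro integral_eq_nn_integral) auto
    finally show ?thesis .
  qed
  have "(\<lambda>q. \<integral>\<^sup>+l. ennreal (\<pi>prior l) \<partial>\<mu>q q) \<in> borel_measurable \<mu>D"
    using disintegration_nn_integral[OF dis _ fib, of "\<lambda>l. ennreal (\<pi>prior l)"] by simp
  then have [measurable]: "?p \<in> borel_measurable \<mu>D"
    using p_eq by (simp cong: measurable_cong)
  have post[measurable]: "\<pi>post \<in> borel_measurable \<mu>\<Lambda>"
    unfolding \<pi>post_def posterior_density_def by measurable
  have post0: "0 \<le> \<pi>post l" if "l \<in> space \<mu>\<Lambda>" for l
    using pos that p_eq measurable_space[OF Q that]
    by (simp add: \<pi>post_def posterior_density_def)
  have dens: "(\<integral>\<^sup>+q. (\<integral>\<^sup>+l\<in>B \<inter> Q -` {q}. ennreal (\<pi>post l) \<partial>\<mu>q q) \<partial>\<mu>D)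
      = emeasure (density \<mu>\<Lambda> (\<lambda>l. ennreal (\<pi>post l))) B" if B: "B \<in> sets \<mu>\<Lambda>" for B
  proof -
    have "(\<integral>\<^sup>+q. (\<integral>\<^sup>+l\<in>B \<inter> Q -` {q}. ennreal (\<pi>post l) \<partial>\<mu>q q) \<partial>\<mu>D)
        = (\<integral>\<^sup>+q. (\<integral>\<^sup>+l. ennreal (\<pi>post l) * indicator B l \<partial>\<mu>q q) \<partial>\<mu>D)"
    proof (rule nn_integral_cong, rule nn_integral_cong_AE)
      fix q assume "q \<in> space \<mu>D"
      from AE_q[OF this]
      show "AE l in \<mu>q q. ennreal (\<pi>post l) * indicator (B \<inter> Q -` {q}) l
              = ennreal (\<pi>post l) * indicator B l"
        by eventually_elim (simp add: indicator_def)
    qed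
    also have "\<dots> = (\<integral>\<^sup>+l. ennreal (\<pi>post l) * indicator B l \<partial>\<mu>\<Lambda>)"
      using disintegration_nn_integral[OF dis _ fib, of "\<lambda>l. ennreal (\<pi>post l) * indicator B l"] B
      by simp
    finally show ?thesis using B by (simp add: emeasure_density)
  qed
  have "posterior \<mu>\<Lambda> \<mu>D Q \<mu>q \<pi>prior \<pi>obs
      = measure_of (space \<mu>\<Lambda>) (sets \<mu>\<Lambda>) (emeasure (density \<mu>\<Lambda> (\<lambda>l. ennreal (\<pi>post l))))"
    unfolding posterior_def
    by (intro measure_of_eq sets.space_closed)
      (simp add: sets.sigma_sets_eq dens[unfolded \<pi>post_def] \<pi>post_def)
  also have "\<dots> = density \<mu>\<Lambda> (\<lambda>l. ennreal (\<pi>post l))"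
    using measure_of_of_measure[of "density \<mu>\<Lambda> (\<lambda>l. ennreal (\<pi>post l))"] by simp
  finally have eq: "posterior \<mu>\<Lambda> \<mu>D Q \<mu>q \<pi>prior \<pi>obs = density \<mu>\<Lambda> (\<lambda>l. ennreal (\<pi>post l))" .
  show "emeasure (posterior \<mu>\<Lambda> \<mu>D Q \<mu>q \<pi>prior \<pi>obs) A =
           (\<integral>\<^sup>+q. (\<integral>\<^sup>+l\<in>A \<inter> Q -` {q}. ennreal (\<pi>post l) \<partial>\<mu>q q) \<partial>\<mu>D)"
    using dens[OF A] eq by simp
  show "has_density \<mu>\<Lambda> (posterior \<mu>\<Lambda> \<mu>D Q \<mu>q \<pi>prior \<pi>obs) \<pi>post"
    using eq post post0 by (simp add: has_density_def)
qed

end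

theory Submission
  imports Defs
begin

text \<open>
  Passing from the observed measure to the consistent solution does not increase total variation
  distance, so stability holds with \<open>\<delta> = \<epsilon>\<close>.  The two posterior densities share the factor
  \<open>\<pi>prior\<close>, and along the fibre of \<open>q\<close> the other factor is the constant \<open>\<pi>obs q / p q\<close>,
  where \<open>p\<close> is the push-forward density of the prior.  Disintegrating along \<open>Q\<close>, the \<open>L\<^sup>1\<close> distance
  of the posterior densities becomes the integral over \<open>q\<close> of
  \<open>\<bar>\<pi>obs q - \<pi>obs' q\<bar> / p q\<close> times the fibre mass \<open>\<integral>\<^sup>+l. \<pi>prior l \<partial>\<mu>q q\<close> of the prior.  That mass is
  \<open>p q\<close> wherever \<open>p q \<noteq> 0\<close>, while the quotient is read as \<open>0\<close> elsewhere.
  The integrand is thus at most \<open>\<bar>\<pi>obs q - \<pi>obs' q\<bar>\<close>.  The inequality is proved fibrewise in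
  \<open>nn_integral_posterior_diff_fibre_le\<close> and integrated in \<open>tv_dist_posterior_le\<close>.
\<close>

lemma disintegration_AE_fibre:
  assumes dis: "disintegration \<mu>\<Lambda> \<mu>D Q \<mu>q" and q: "q \<in> space \<mu>D"
    and fib: "space \<mu>\<Lambda> \<inter> Q -` {q} \<in> sets \<mu>\<Lambda>"
  shows "AE l in \<mu>q q. Q l = q"
proof (rule AE_I)
  have sets_q: "sets (\<mu>q q) = sets \<mu>\<Lambda>"
    using dis q by (simp add: disintegration_def)
  show "{l \<in> space (\<mu>q q). Q l \<noteq> q} \<subseteq> space \<mu>\<Lambda> - Q -` {q}"
    using sets_eq_imp_space_eq[OF sets_q] by auto
  show "emeasure (\<mu>q q) (space \<mu>\<Lambda> - Q -` {q}) = 0"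
    using dis q by (simp add: disintegration_def)
  have "space \<mu>\<Lambda> - (space \<mu>\<Lambda> \<inter> Q -` {q}) \<in> sets \<mu>\<Lambda>"
    using fib by blast
  then show "space \<mu>\<Lambda> - Q -` {q} \<in> sets (\<mu>q q)"
    using sets_q by (simp add: Diff_Int)
qed

text \<open>
  The push-forward density is a Bochner integral, which is \<open>0\<close> when the prior is not integrable over
  the fibre.  Hence a nonzero value certifies integrability and is the true fibre mass of the prior.
\<close>

lemma nn_integral_prior_fibre_eq:
  assumes dis: "disintegration \<mu>\<Lambda> \<mu>D Q \<mu>q" and q: "q \<in> space \<mu>D"
    and fib: "space \<mu>\<Lambda> \<inter> Q -` {q} \<in> sets \<mu>\<Lambda>"
    and prior: "has_density \<mu>\<Lambda> Pprior \<pi>prior"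
    and nz: "push_prior_density \<mu>\<Lambda> Q \<mu>q \<pi>prior q \<noteq> 0"
  shows "(\<integral>\<^sup>+l. ennreal (\<pi>prior l) \<partial>\<mu>q q) = ennreal (push_prior_density \<mu>\<Lambda> Q \<mu>q \<pi>prior q)"
proof -
  have sets_q: "sets (\<mu>q q) = sets \<mu>\<Lambda>"
    using dis q by (simp add: disintegration_def)
  note space_q = sets_eq_imp_space_eq[OF sets_q]
  let ?F = "space \<mu>\<Lambda> \<inter> Q -` {q}"
  have on_F: "AE l in \<mu>q q. l \<in> ?F"
    using disintegration_AE_fibre[OF dis q fib] AE_space
    by eventually_elim (simp add: space_q)
  have "integrable (\<mu>q q) (\<lambda>l. indicat_real ?F l *\<^sub>R \<pi>prior l)"
    using nz not_integrable_integral_eq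
    unfolding push_prior_density_def set_lebesgue_integral_def by blast
  moreover have "AE l in \<mu>q q. 0 \<le> indicat_real ?F l *\<^sub>R \<pi>prior l"
    using prior by (auto simp: has_density_def indicator_def)
  ultimately have "(\<integral>\<^sup>+l. ennreal (indicat_real ?F l *\<^sub>R \<pi>prior l) \<partial>\<mu>q q)
      = ennreal (push_prior_density \<mu>\<Lambda> Q \<mu>q \<pi>prior q)"
    unfolding push_prior_density_def set_lebesgue_integral_def by (rule nn_integral_eq_integral)
  moreover have "(\<integral>\<^sup>+l. ennreal (indicat_real ?F l *\<^sub>R \<pi>prior l) \<partial>\<mu>q q)
      = (\<integral>\<^sup>+l. ennreal (\<pi>prior l) \<partial>\<mu>q q)"
    by (rule nn_integral_cong_AE) (use on_F in eventually_elim, simp)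
  ultimately show ?thesis by simp
qed

text \<open>
  On the fibre of \<open>q\<close> the difference of the posterior densities is the prior density times a constant
  with denominator \<open>p q\<close>, and \<open>p q\<close> cancels against the fibre mass of the prior.  Only an
  inequality holds, because the left-hand side vanishes where \<open>p q = 0\<close>.
\<close>

lemma nn_integral_posterior_diff_fibre_le:
  assumes dis: "disintegration \<mu>\<Lambda> \<mu>D Q \<mu>q" and q: "q \<in> space \<mu>D"
    and fib: "space \<mu>\<Lambda> \<inter> Q -` {q} \<in> sets \<mu>\<Lambda>"
    and prior: "has_density \<mu>\<Lambda> Pprior \<pi>prior"
  shows "(\<integral>\<^sup>+l. ennreal \<bar>posterior_density \<mu>\<Lambda> Q \<mu>q \<pi>prior f l
              - posterior_density \<mu>\<Lambda> Q \<mu>q \<pi>prior g l\<bar> \<partial>\<mu>q q)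
         \<le> ennreal \<bar>f q - g q\<bar>"
proof -
  let ?p = "push_prior_density \<mu>\<Lambda> Q \<mu>q \<pi>prior q"
  let ?c = "\<bar>f q - g q\<bar> / \<bar>?p\<bar>"
  have sets_q: "sets (\<mu>q q) = sets \<mu>\<Lambda>"
    using dis q by (simp add: disintegration_def)
  have pos: "0 \<le> \<pi>prior l" if "l \<in> space (\<mu>q q)" for l
    using prior that sets_eq_imp_space_eq[OF sets_q] by (simp add: has_density_def)
  have [measurable]: "\<pi>prior \<in> borel_measurable (\<mu>q q)"
    using prior measurable_cong_sets[OF sets_q refl] unfolding has_density_def by blast
  have "(\<integral>\<^sup>+l. ennreal \<bar>posterior_density \<mu>\<Lambda> Q \<mu>q \<pi>prior f l
            - posterior_density \<mu>\<Lambda> Q \<mu>q \<pi>prior g l\<bar> \<partial>\<mu>q q)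
      = (\<integral>\<^sup>+l. ennreal (\<pi>prior l) * ennreal ?c \<partial>\<mu>q q)"
  proof (rule nn_integral_cong_AE)
    show "AE l in \<mu>q q. ennreal \<bar>posterior_density \<mu>\<Lambda> Q \<mu>q \<pi>prior f l
              - posterior_density \<mu>\<Lambda> Q \<mu>q \<pi>prior g l\<bar> = ennreal (\<pi>prior l) * ennreal ?c"
      using disintegration_AE_fibre[OF dis q fib] AE_space
    proof eventually_elim
      case (elim l)
      have "posterior_density \<mu>\<Lambda> Q \<mu>q \<pi>prior f l - posterior_density \<mu>\<Lambda> Q \<mu>q \<pi>prior g l
          = \<pi>prior l * ((f q - g q) / ?p)"
        using elim(1) by (simp add: posterior_density_def right_diff_distrib diff_divide_distrib)
      then show ?case
        using pos[OF elim(2)] by (simp add: abs_mult flip: ennreal_mult)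
    qed
  qed
  also have "\<dots> = (\<integral>\<^sup>+l. ennreal (\<pi>prior l) \<partial>\<mu>q q) * ennreal ?c"
    by (rule nn_integral_multc) measurable
  also have "\<dots> \<le> ennreal \<bar>f q - g q\<bar>"
  proof (cases "?p = 0")
    \<comment> \<open>The fibre mass of the prior may be infinite here, but it is multiplied by \<open>ennreal 0\<close>.\<close>
    case True
    then show ?thesis by simp
  next
    case False
    have "(\<integral>\<^sup>+l. ennreal (\<pi>prior l) \<partial>\<mu>q q) * ennreal ?c \<le> ennreal \<bar>?p\<bar> * ennreal ?c"
      unfolding nn_integral_prior_fibre_eq[OF dis q fib prior False]
      by (intro mult_right_mono ennreal_leI) auto
    also have "\<dots> = ennreal \<bar>f q - g q\<bar>"
      using False by (simp flip: ennreal_mult)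
    finally show ?thesis .
  qed
  finally show ?thesis .
qed

text \<open>
  The infimum in \<open>tv_dist\<close> bounds the posterior distance by the integral for the explicit posterior
  densities.  The observed distance must be evaluated exactly, which is where finiteness of the
  observed measures enters: it makes their densities unique almost everywhere.
\<close>

lemma tv_dist_posterior_le:
  assumes dis: "disintegration \<mu>\<Lambda> \<mu>D Q \<mu>q"
    and fib: "\<And>q. q \<in> space \<mu>D \<Longrightarrow> space \<mu>\<Lambda> \<inter> Q -` {q} \<in> sets \<mu>\<Lambda>"
    and Q: "Q \<in> \<mu>\<Lambda> \<rightarrow>\<^sub>M \<mu>D"
    and prior: "has_density \<mu>\<Lambda> Pprior \<pi>prior"
    and f: "has_density \<mu>D P1 f" "finite_measure P1"
    and g: "has_density \<mu>D P2 g" "finite_measure P2"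
  shows "tv_dist \<mu>\<Lambda> (posterior \<mu>\<Lambda> \<mu>D Q \<mu>q \<pi>prior f) (posterior \<mu>\<Lambda> \<mu>D Q \<mu>q \<pi>prior g)
         \<le> tv_dist \<mu>D P1 P2"
proof -
  let ?f = "posterior_density \<mu>\<Lambda> Q \<mu>q \<pi>prior f"
  let ?g = "posterior_density \<mu>\<Lambda> Q \<mu>q \<pi>prior g"
  have dens: "has_density \<mu>\<Lambda> (posterior \<mu>\<Lambda> \<mu>D Q \<mu>q \<pi>prior f) ?f"
      "has_density \<mu>\<Lambda> (posterior \<mu>\<Lambda> \<mu>D Q \<mu>q \<pi>prior g) ?g"
    using emeasure_posterior(2)[OF dis fib Q prior f(1) sets.empty_sets]
      emeasure_posterior(2)[OF dis fib Q prior g(1) sets.empty_sets] by auto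
  then have [measurable]: "?f \<in> borel_measurable \<mu>\<Lambda>" "?g \<in> borel_measurable \<mu>\<Lambda>"
    by (auto simp: has_density_def)
  have "tv_dist \<mu>\<Lambda> (posterior \<mu>\<Lambda> \<mu>D Q \<mu>q \<pi>prior f) (posterior \<mu>\<Lambda> \<mu>D Q \<mu>q \<pi>prior g)
      \<le> (\<integral>\<^sup>+l. ennreal \<bar>?f l - ?g l\<bar> \<partial>\<mu>\<Lambda>)"
    unfolding tv_dist_def by (rule Inf_lower) (use dens in blast)
  also have "\<dots> = (\<integral>\<^sup>+q. (\<integral>\<^sup>+l. ennreal \<bar>?f l - ?g l\<bar> \<partial>\<mu>q q) \<partial>\<mu>D)"
    using disintegration_nn_integral[OF dis _ fib, of "\<lambda>l. ennreal \<bar>?f l - ?g l\<bar>"] by simp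
  also have "\<dots> \<le> (\<integral>\<^sup>+q. ennreal \<bar>f q - g q\<bar> \<partial>\<mu>D)"
    by (intro nn_integral_mono nn_integral_posterior_diff_fibre_le[OF dis _ fib prior])
  also have "\<dots> = tv_dist \<mu>D P1 P2"
    by (rule tv_dist_eq[symmetric]) (use f g in auto)
  finally show ?thesis .
qed

theorem theorem4p1:
  fixes \<Lambda> :: "(real ^ 'n) set" and D :: "(real ^ 'm) set"
    and Q :: "real ^ 'n \<Rightarrow> real ^ 'm"
    and \<mu>\<Lambda> Pprior :: "(real ^ 'n) measure"
    and \<mu>D Pobs :: "(real ^ 'm) measure"
    and \<mu>q :: "real ^ 'm \<Rightarrow> (real ^ 'n) measure"
    and \<pi>prior :: "real ^ 'n \<Rightarrow> real" and \<pi>obs :: "real ^ 'm \<Rightarrow> real"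
  assumes "sets \<mu>\<Lambda> = sets (restrict_space borel \<Lambda>)"
    and "sets \<mu>D = sets (restrict_space borel D)"
    and "Q \<in> \<mu>\<Lambda> \<rightarrow>\<^sub>M \<mu>D" and "D = Q ` \<Lambda>"
    and "\<mu>D = distr \<mu>\<Lambda> \<mu>D Q \<or> absolutely_continuous \<mu>D (distr \<mu>\<Lambda> \<mu>D Q)"
    and "disintegration \<mu>\<Lambda> \<mu>D Q \<mu>q"
    and "prob_space Pprior" and "has_density \<mu>\<Lambda> Pprior \<pi>prior"
    and "prob_space Pobs" and "has_density \<mu>D Pobs \<pi>obs" and "predictable \<mu>D (push_prior_density \<mu>\<Lambda> Q \<mu>q \<pi>prior) \<pi>obs"
  shows "\<forall>\<epsilon>::real. \<epsilon> > 0 \<longrightarrow> (\<exists>\<delta>::real. \<delta> > 0 \<and>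
    (\<forall>(Pobs' :: (real ^ 'm) measure) \<pi>obs'.
       prob_space Pobs' \<and> has_density \<mu>D Pobs' \<pi>obs' \<and> predictable \<mu>D (push_prior_density \<mu>\<Lambda> Q \<mu>q \<pi>prior) \<pi>obs' \<longrightarrow>
       tv_dist \<mu>D Pobs Pobs' < ennreal \<delta> \<longrightarrow>
       tv_dist \<mu>\<Lambda> (posterior \<mu>\<Lambda> \<mu>D Q \<mu>q \<pi>prior \<pi>obs)
                  (posterior \<mu>\<Lambda> \<mu>D Q \<mu>q \<pi>prior \<pi>obs') < ennreal \<epsilon>))"
proof -
  have fib: "space \<mu>\<Lambda> \<inter> Q -` {q} \<in> sets \<mu>\<Lambda>" if "q \<in> space \<mu>D" for q
  proof -
    have "space \<mu>D = D"
      using sets_eq_imp_space_eq[OF assms(2)] by (simp add: space_restrict_space)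
    then have "D \<inter> {q} = {q}"
      using that by blast
    moreover have "D \<inter> {q} \<in> sets \<mu>D"
      unfolding assms(2) sets_restrict_space by (rule imageI) simp
    ultimately have "{q} \<in> sets \<mu>D"
      by simp
    then show ?thesis
      using measurable_sets[OF assms(3)] by (simp add: Int_commute)
  qed
  have "tv_dist \<mu>\<Lambda> (posterior \<mu>\<Lambda> \<mu>D Q \<mu>q \<pi>prior \<pi>obs) (posterior \<mu>\<Lambda> \<mu>D Q \<mu>q \<pi>prior \<pi>obs')
      \<le> tv_dist \<mu>D Pobs Pobs'"
    if "prob_space Pobs'" "has_density \<mu>D Pobs' \<pi>obs'" for Pobs' \<pi>obs'
    using assms(6) fib assms(3) assms(8) assms(10) prob_space.finite_measure[OF assms(9)]
      that(2) prob_space.finite_measure[OF that(1)]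
    by (rule tv_dist_posterior_le)
  then show ?thesis
    by (blast intro: le_less_trans)
qed

end
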